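(* Let $n\geq 2$. Let $\bar p_1,\dots,\bar p_n,\bar p_{n+1}\in\mathbb{RP}^n$ be generic and let $\bar p_{n+2}\in\mathbb{RP}^n$ be a projective point satisfying $\bar p_{n+2}\notin\overline{\mathrm{sp}}\{\bar p_1,\dots,\bar p_n\}$ and $\bar p_{n+2}\neq\bar p_{n+1}$. Let $F:\mathbb{RP}^n\to\mathbb{RP}^n$ be an injective mapping that maps any projective line containing one of the points $\bar p_1,\dots,\bar p_{n+2}$ onto a projective line. Then $F$ is a projective-linear mapping.
   Context: $\mathbb{RP}^n$ is real projective $n$-space, i.e. the set of one-dimensional subspaces of $\mathbb{R}^{n+1}$. A lift of a projective point is a nonzero vector of $\mathbb{R}^{n+1}$ spanning it. $\overline{\mathrm{sp}}\{\bar p_1,\dots,\bar p_k\}$ is the projective span, i.e. the projective subspace of least dimension containing these points. Points $\bar a_1,\dots,\bar a_m\in\mathbb{RP}^n$ are generic (in general position) if, for each $k\leq n+1$, any $k$ of their corresponding lifts $a_1,\dots,a_m\in\mathbb{R}^{n+1}$ are linearly independent. $F$ maps a projective line $l$ onto a projective line if $F(l)$ is equal to a projective line. A projective-linear mapping of $\mathbb{RP}^n$ is a map induced by an invertible linear transformation of $\mathbb{R}^{n+1}$. No continuity is assumed. *)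

theory Defs
  imports "HOL-Analysis.Analysis"
begin

text \<open>
  Real projective \<open>n\<close>-space is a set of subspaces of \<open>real ^ 'm\<close>, where \<open>CARD('m) = n + 1\<close>; a
  projective subspace is the set of the projective points contained in a linear subspace.
\<close>

definition RP :: "(real ^ 'm) set set" where
  "RP = {L. subspace L \<and> dim L = 1}"

definition is_lift :: "real ^ 'm \<Rightarrow> (real ^ 'm) set \<Rightarrow> bool" where
  "is_lift v L \<longleftrightarrow> v \<noteq> 0 \<and> span {v} = L"

definition projectivization :: "(real ^ 'm) set \<Rightarrow> (real ^ 'm) set set" where
  "projectivization V = {L \<in> RP. L \<subseteq> V}"

definition proj_line :: "(real ^ 'm) set set \<Rightarrow> bool" where
  "proj_line l \<longleftrightarrow> (\<exists>V. subspace V \<and> dim V = 2 \<and> l = projectivization V)"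

text \<open>
  The projectivization of \<open>V\<close> has projective dimension \<open>dim V - 1\<close>, so minimizing \<open>dim V\<close>
  minimizes the projective dimension. The lemma below identifies the result with the linear
  span of the points, so it does not depend on the choice made by \<open>ARG_MIN\<close>.
\<close>

definition proj_span :: "(real ^ 'm) set set \<Rightarrow> (real ^ 'm) set set" where
  "proj_span A = projectivization (ARG_MIN dim V. subspace V \<and> A \<subseteq> projectivization V)"

lemma proj_span_eq:
  fixes A :: "(real ^ 'm) set set"
  assumes "A \<subseteq> RP"
  shows "proj_span A = projectivization (span (\<Union>A))"
proof -
  let ?P = "\<lambda>V. subspace V \<and> A \<subseteq> projectivization V"
  let ?W = "ARG_MIN dim V. ?P V"
  have P: "?P (span (\<Union>A))"
    using assms by (auto simp: projectivization_def intro: span_base)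
  have W: "?P ?W" "dim ?W \<le> dim (span (\<Union>A))"
    using arg_min_nat_lemma[of ?P, OF P, of dim] P by auto
  have "span (\<Union>A) \<subseteq> ?W"
    using W(1) by (intro span_minimal) (auto simp: projectivization_def)
  with W have "span (\<Union>A) = ?W"
    by (intro subspace_dim_equal) auto
  then show ?thesis
    by (simp add: proj_span_def)
qed

text \<open>
  The points are a family \<open>a 1, \<dots>, a m\<close>, so linear independence is that of the family of lifts:
  the injectivity condition rules out repeated lifts.
\<close>

definition generic :: "nat \<Rightarrow> (nat \<Rightarrow> (real ^ 'm) set) \<Rightarrow> bool" where
  "generic m a \<longleftrightarrow>
    (\<forall>v. (\<forall>i\<in>{1..m}. is_lift (v i) (a i)) \<longrightarrow>
      (\<forall>J\<subseteq>{1..m}. card J \<le> CARD('m) \<longrightarrow> inj_on v J \<and> independent (v ` J)))"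

text \<open>Only the values of \<open>F\<close> on \<open>RP\<close> are relevant.\<close>

definition projective_linear :: "((real ^ 'm) set \<Rightarrow> (real ^ 'm) set) \<Rightarrow> bool" where
  "projective_linear F \<longleftrightarrow> (\<exists>f. linear f \<and> bij f \<and> (\<forall>L\<in>RP. F L = f ` L))"

end

theory Submission
  imports Defs
begin

text \<open>
  Call the points \<open>p i\<close> centres. A subspace spanned by centres is built up from a centre by
  repeatedly joining it to a further centre with lines, and all these lines go onto lines. Hence
  \<open>F\<close> maps the span of independent centres onto the span of their images, and by injectivity the
  images are again independent (\<open>span_of_centres\<close>). Composing with linear maps on both sides we
  may therefore assume that the first \<open>n + 1\<close> centres are the coordinate axes and that \<open>F\<close> fixes
  each of them. Then \<open>F\<close> preserves the hyperplane \<open>H\<close> spanned by the first \<open>n\<close> centres, and it acts on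
  the affine space outside \<open>H\<close>, whose origin is the centre \<open>p (n + 1)\<close>.

  In this affine chart the lines through one of the first \<open>n\<close> centres are the parallels to a
  coordinate axis. They go to parallels to the same axis, so changing one coordinate of a point
  changes only this coordinate of the image: \<open>F\<close> acts on each coordinate separately
  (\<open>g_coordinatewise\<close>). The lines through the origin force all these coordinate functions to be
  multiples of one multiplicative injective function \<open>f\<close>
  (\<open>coord_common_multiplicative\<close>). The last centre \<open>p (n + 2)\<close> is a point of the chart
  other than the origin. The lines through it turn, in two coordinates, into an equation between
  the slopes of the image, and this equation makes \<open>f\<close> additive
  (\<open>multiplicative_slope_equation_eq_id\<close>). A ring endomorphism of the reals is the identity,
  so \<open>F\<close> is diagonal on the chart; each point of \<open>H\<close> is the missing point of a line through the
  origin, so \<open>F\<close> is given by the same diagonal map there.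
\<close>

section \<open>A functional equation that characterises the identity of the real line\<close>

text \<open>
  Nonnegative numbers are squares and go to squares, so \<open>f\<close> is monotone, and it fixes the rationals.
\<close>
lemma real_ring_endomorphism_eq_id:
  fixes f :: "real \<Rightarrow> real"
  assumes add: "\<And>x y. f (x + y) = f x + f y"
    and mult: "\<And>x y. f (x * y) = f x * f y"
    and one: "f 1 = 1"
  shows "f x = x"
proof -
  have zero: "f 0 = 0"
    using add[of 0 0] by simp
  have neg: "f (- x) = - f x" for x
    using add[of x "- x"] zero by simp
  have nat: "f (of_nat k) = of_nat k" for k
    by (induction k) (auto simp: zero add one)
  have int: "f (of_int k) = of_int k" for k
    by (cases k) (auto simp: nat neg simp del: of_nat_Suc)
  have rat: "f q = q" if q_rat: "q \<in> \<rat>" for q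
  proof -
    obtain k :: int and m :: int where m: "m > 0" and q: "q = of_int k / of_int m"
      using Rats_cases'[OF q_rat] by blast
    have "q * of_int m = of_int k"
      using m q by simp
    moreover from this have "f q * of_int m = of_int k"
      using mult[of q "of_int m"] int by simp
    ultimately show ?thesis
      using m by (metis mult_cancel_right of_int_eq_0_iff less_irrefl)
  qed
  have nonneg: "0 \<le> f t" if "0 \<le> t" for t
    using mult[of "sqrt t" "sqrt t"] that by simp
  have mono: "f s \<le> f t" if "s \<le> t" for s t
    using nonneg[of "t - s"] add[of "t - s" s] that by simp
  show ?thesis
  proof (rule linorder_cases[of "f x" x])
    assume "f x < x"
    then obtain q where "q \<in> \<rat>" "f x < q" "q < x"
      using Rats_dense_in_real by blast
    then show ?thesis
      using mono[of q x] rat[of q] by simp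
  next
    assume "x < f x"
    then obtain q where "q \<in> \<rat>" "x < q" "q < f x"
      using Rats_dense_in_real by blast
    then show ?thesis
      using mono[of x q] rat[of q] by simp
  qed
qed

text \<open>
  The slope equation says that \<open>(x, y) \<mapsto> (f x, f y)\<close> sends the points \<open>(1 + t, b + t * m)\<close> of a line
  through \<open>(1, b)\<close> to collinear points. If \<open>b = 0\<close>, it gives \<open>f (1 + t) = 1 + f t\<close>. Otherwise
  multiplicativity allows us to rescale \<open>b\<close> to \<open>1\<close>; then \<open>f\<close> respects the reflection at \<open>1\<close>, hence,
  again by scaling, it respects midpoints. In both cases \<open>f\<close> is additive.
\<close>
lemma multiplicative_slope_equation_eq_id:
  fixes f :: "real \<Rightarrow> real"
  assumes inj: "inj f"
    and mult: "\<And>x y. f (x * y) = f x * f y"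
    and slope: "\<And>t m. (f (b + t * m) - f b) * (f 2 - 1) = (f (1 + t) - 1) * (f (b + m) - f b)"
  shows "f x = x"
proof -
  have neq: "f s \<noteq> f t" if "s \<noteq> t" for s t
    using inj that by (auto dest: injD)
  have "f 0 * f 1 = f 0 * f 2"
    by (simp flip: mult)
  then have zero: "f 0 = 0"
    using neq[of 1 2] by simp
  have "f 1 * f 1 = f 1 * 1"
    by (simp flip: mult)
  then have one: "f 1 = 1"
    using neq[of 1 0] zero by simp
  have "f (-1) * f (-1) = 1"
    using one by (simp flip: mult)
  then have minus_one: "f (-1) = -1"
    using neq[of "-1" 1] one by (simp add: square_eq_1_iff)
  have neg: "f (- t) = - f t" for t
    using mult[of "-1" t] minus_one by simp
  have "f (s + t) = f s + f t" for s t
  proof (cases "b = 0")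
    case True
    have step: "f t * (f 2 - 1) = f (1 + t) - 1" for t
      using slope[of t 1] True zero one by simp
    \<comment> \<open>The value \<open>t = -1\<close> determines the constant factor.\<close>
    have "f 2 = 2"
      using step[of "-1"] minus_one zero by simp
    then have step: "f (1 + t) = 1 + f t" for t
      using step[of t] by simp
    show ?thesis
    proof (cases "s = 0")
      case False
      have "f (s + t) = f (s * (1 + t / s))"
        using False by (simp add: distrib_left)
      also have "\<dots> = f s * f (1 + t / s)"
        by (rule mult)
      also have "\<dots> = f s + f t"
        using False by (simp add: step distrib_left flip: mult)
      finally show ?thesis .
    qed (simp add: zero)
  next
    case False
    have h: "(f (1 + t * m) - 1) * (f 2 - 1) = (f (1 + t) - 1) * (f (1 + m) - 1)" for t m
    proof -
      have scale: "f (b + b * r) - f b = f b * (f (1 + r) - 1)" for r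
        using mult[of b "1 + r"] by (simp add: algebra_simps)
      have "f b \<noteq> 0"
        using neq[OF False] zero by simp
      then show ?thesis
        using slope[of t "b * m"] scale[of m] scale[of "t * m"]
        by (simp add: mult.left_commute)
    qed
    \<comment> \<open>Injectivity excludes \<open>f 2 - 1 = -1\<close>, since \<open>f 0 = 0\<close>.\<close>
    have "(f 2 - 1) * (f 2 - 1) = 1"
      using h[of "-1" "-1"] zero by simp
    then have "f 2 - 1 = 1 \<or> f 2 - 1 = -1"
      by (simp add: square_eq_1_iff)
    then have two: "f 2 = 2"
      using neq[of 2 0] zero by auto
    have refl: "f (1 + t) + f (1 - t) = 2" for t
      using h[of t "-1"] two zero by simp
    show ?thesis
    proof (cases "s + t = 0")
      case True
      then have "t = - s" by simp
      then show ?thesis by (simp add: neg zero)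
    next
      case False
      define c where "c = (s + t) / 2"
      define r where "r = (s - t) / (s + t)"
      have "s = c * (1 + r)" "t = c * (1 - r)" "s + t = 2 * c"
        using False by (auto simp: c_def r_def field_simps)
      then have "f s = f c * f (1 + r)" "f t = f c * f (1 - r)" "f (s + t) = 2 * f c"
        using two by (simp_all only: mult)
      then have "f s + f t = f c * (f (1 + r) + f (1 - r))" "f (s + t) = f c * 2"
        by (simp_all add: distrib_left)
      then show ?thesis
        by (simp add: refl)
    qed
  qed
  then show ?thesis
    by (rule real_ring_endomorphism_eq_id[OF _ mult one])
qed

section \<open>Maps of lifts that send lines through centres onto lines\<close>

text \<open>
  The map \<open>\<phi>\<close> chooses a lift of the image of each projective point, given by one of its lifts, and
  \<open>C\<close> is a set of lifts of centres. The axioms \<open>line_into\<close> and \<open>line_onto\<close> say that the line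
  joining the centre \<open>a\<close> to \<open>y\<close> goes onto the line joining their images; \<open>span_iff\<close> says that the
  induced map of projective points is well defined and injective.
\<close>
locale star_collineation =
  fixes \<phi> :: "real ^ 'm \<Rightarrow> real ^ 'm" and C :: "(real ^ 'm) set"
  assumes nonzero: "x \<noteq> 0 \<Longrightarrow> \<phi> x \<noteq> 0"
    and span_iff: "x \<noteq> 0 \<Longrightarrow> y \<noteq> 0 \<Longrightarrow> \<phi> y \<in> span {\<phi> x} \<longleftrightarrow> y \<in> span {x}"
    and centre_nonzero: "a \<in> C \<Longrightarrow> a \<noteq> 0"
    and line_into: "a \<in> C \<Longrightarrow> y \<notin> span {a} \<Longrightarrow> x \<in> span {a, y} \<Longrightarrow> x \<noteq> 0
      \<Longrightarrow> \<phi> x \<in> span {\<phi> a, \<phi> y}"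
    and line_onto: "a \<in> C \<Longrightarrow> y \<notin> span {a} \<Longrightarrow> u \<in> span {\<phi> a, \<phi> y} \<Longrightarrow> u \<noteq> 0
      \<Longrightarrow> \<exists>x\<in>span {a, y}. x \<noteq> 0 \<and> u \<in> span {\<phi> x}"

lemma span_singleton_swap:
  fixes x y :: "'a :: real_vector"
  assumes "x \<in> span {y}" "x \<noteq> 0"
  shows "y \<in> span {x}"
proof -
  obtain c where c: "x = c *\<^sub>R y"
    using assms by (auto simp: span_singleton)
  with assms have "y = (1 / c) *\<^sub>R x" by auto
  then show ?thesis
    by (metis span_base span_scale insertI1)
qed

lemma span_singleton_eq:
  fixes x y :: "'a :: real_vector"
  assumes "x \<in> span {y}" "x \<noteq> 0"
  shows "span {x} = span {y}"
  using assms span_singleton_swap[OF assms]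
  by (intro equalityI span_minimal) auto

lemma in_span_insert_subspace:
  assumes "y \<in> span B" "x \<in> span {a, y}"
  shows "x \<in> span (insert a B)"
proof -
  have "span {a, y} \<subseteq> span (insert a B)"
    using assms span_mono[of B "insert a B"] by (intro span_minimal) (auto intro: span_base)
  then show ?thesis using assms by blast
qed

context star_collineation
begin

text \<open>
  The induction step adds one centre \<open>a\<close>. Each point of the larger subspace lies on a line that
  joins \<open>a\<close> to a point of \<open>span B\<close>, and the same holds for the images. Surjectivity onto
  \<open>span (\<phi> ` B)\<close> is part of the induction because it gives independence: if \<open>\<phi> a\<close> were in that
  span, it would be the image of a point of \<open>span B\<close>, which contradicts injectivity.
\<close>
lemma span_of_centres:
  assumes "finite B" "B \<subseteq> C" "independent B"
  shows "(\<forall>x\<in>span B. x \<noteq> 0 \<longrightarrow> \<phi> x \<in> span (\<phi> ` B))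
    \<and> (\<forall>u\<in>span (\<phi> ` B). u \<noteq> 0 \<longrightarrow> (\<exists>x\<in>span B. x \<noteq> 0 \<and> u \<in> span {\<phi> x}))
    \<and> independent (\<phi> ` B) \<and> inj_on \<phi> B"
  using assms
proof (induction B rule: finite_induct)
  case empty
  show ?case by (simp add: independent_empty)
next
  case (insert a B)
  have indep: "independent B" and aB: "a \<notin> span B"
    using insert.prems insert.hyps by (auto simp: independent_insert)
  have aC: "a \<in> C" using insert.prems by simp
  have into: "\<phi> x \<in> span (\<phi> ` B)" if "x \<in> span B" "x \<noteq> 0" for x
    using insert.IH insert.prems indep that by blast
  have onto: "\<exists>x\<in>span B. x \<noteq> 0 \<and> u \<in> span {\<phi> x}" if "u \<in> span (\<phi> ` B)" "u \<noteq> 0" for u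
    using insert.IH insert.prems indep that by blast
  have IH: "independent (\<phi> ` B)" "inj_on \<phi> B"
    using insert.IH insert.prems indep by blast+
  have ya: "y \<notin> span {a}" if "y \<in> span B" "y \<noteq> 0" for y
    using span_singleton_swap[of y a] that aB span_minimal[of "{y}" "span B"] by auto
  have a0: "a \<noteq> 0" using centre_nonzero aC by blast
  have new: "\<phi> a \<notin> span (\<phi> ` B)"
  proof
    assume "\<phi> a \<in> span (\<phi> ` B)"
    then obtain x where "x \<in> span B" "x \<noteq> 0" "\<phi> a \<in> span {\<phi> x}"
      using onto nonzero[OF a0] by blast
    then show False
      using span_iff[of x a] a0 aB span_minimal[of "{x}" "span B"] by auto
  qed
  have "\<phi> x \<in> span (\<phi> ` insert a B)" if x: "x \<in> span (insert a B)" "x \<noteq> 0" for x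
  proof -
    obtain k where y: "x - k *\<^sub>R a \<in> span B"
      using x by (auto simp: span_insert)
    define y where "y = x - k *\<^sub>R a"
    show ?thesis
    proof (cases "y = 0")
      case True
      then have "x \<in> span {a}" by (auto simp: y_def span_singleton)
      then have "\<phi> x \<in> span {\<phi> a}" using span_iff[of a x] a0 x by blast
      then show ?thesis using span_mono[of "{\<phi> a}" "\<phi> ` insert a B"] by auto
    next
      case False
      have "x = k *\<^sub>R a + y" by (simp add: y_def)
      then have "x \<in> span {a, y}"
        by (metis span_add span_base span_scale insertI1 insertI2)
      then have "\<phi> x \<in> span {\<phi> a, \<phi> y}"
        using line_into[OF aC ya] False y x y_def by blast
      then show ?thesis
        using in_span_insert_subspace[OF into] y False y_def by fastforce
    qed
  qed
  moreover have "\<exists>x\<in>span (insert a B). x \<noteq> 0 \<and> u \<in> span {\<phi> x}"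
    if u: "u \<in> span (\<phi> ` insert a B)" "u \<noteq> 0" for u
  proof -
    obtain k where v: "u - k *\<^sub>R \<phi> a \<in> span (\<phi> ` B)"
      using u by (auto simp: span_insert)
    define v where "v = u - k *\<^sub>R \<phi> a"
    show ?thesis
    proof (cases "v = 0")
      case True
      then have "u \<in> span {\<phi> a}" by (auto simp: v_def span_singleton)
      then show ?thesis using a0 by (intro bexI[of _ a]) (auto intro: span_base)
    next
      case False
      then obtain y where y: "y \<in> span B" "y \<noteq> 0" "v \<in> span {\<phi> y}"
        using onto v v_def by blast
      have "u = k *\<^sub>R \<phi> a + v" by (simp add: v_def)
      moreover have "v \<in> span {\<phi> a, \<phi> y}"
        using y(3) span_mono[of "{\<phi> y}" "{\<phi> a, \<phi> y}"] by auto
      ultimately have "u \<in> span {\<phi> a, \<phi> y}"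
        by (metis span_add span_base span_scale insertI1)
      then obtain x where "x \<in> span {a, y}" "x \<noteq> 0" "u \<in> span {\<phi> x}"
        using line_onto[OF aC ya] y u by blast
      then show ?thesis
        using in_span_insert_subspace y by blast
    qed
  qed
  moreover have "independent (\<phi> ` insert a B)"
    using IH new by (simp add: independent_insertI)
  moreover have "inj_on \<phi> (insert a B)"
    using IH new insert.hyps by (auto intro: span_base)
  ultimately show ?case by blast
qed

lemma in_span_of_centres_iff:
  assumes "finite B" "B \<subseteq> C" "independent B" "x \<noteq> 0"
  shows "\<phi> x \<in> span (\<phi> ` B) \<longleftrightarrow> x \<in> span B"
proof
  assume "\<phi> x \<in> span (\<phi> ` B)"
  then obtain y where "y \<in> span B" "y \<noteq> 0" "\<phi> x \<in> span {\<phi> y}"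
    using span_of_centres[OF assms(1-3)] nonzero[OF assms(4)] by blast
  then show "x \<in> span B"
    using span_iff[of y x] assms(4) span_minimal[of "{y}" "span B"] by auto
qed (use span_of_centres[OF assms(1-3)] assms(4) in blast)

lemma transport:
  fixes A T :: "real ^ 'm \<Rightarrow> real ^ 'm"
  assumes A: "linear A" "bij A" and T: "linear T" "bij T"
  shows "star_collineation (\<lambda>x. T (\<phi> (A x))) (A -` C)"
proof -
  have A_span: "A x \<in> span (A ` S) \<longleftrightarrow> x \<in> span S" for x S
    using A by (simp add: linear_span_image inj_image_mem_iff bij_is_inj)
  have T_span: "T x \<in> span (T ` S) \<longleftrightarrow> x \<in> span S" for x S
    using T by (simp add: linear_span_image inj_image_mem_iff bij_is_inj)
  have A0: "A x = 0 \<longleftrightarrow> x = 0" for x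
    using A by (metis linear_0 bij_is_inj injD)
  have T0: "T x = 0 \<longleftrightarrow> x = 0" for x
    using T by (metis linear_0 bij_is_inj injD)
  note A1 = A_span[of _ "{_}", simplified] and A2 = A_span[of _ "{_, _}", simplified]
  note T1 = T_span[of _ "{_}", simplified] and T2 = T_span[of _ "{_, _}", simplified]
  show ?thesis
  proof
    fix x :: "real ^ 'm" assume "x \<noteq> 0"
    then show "T (\<phi> (A x)) \<noteq> 0"
      by (simp add: T0 A0 nonzero)
  next
    fix x y :: "real ^ 'm" assume "x \<noteq> 0" "y \<noteq> 0"
    then show "T (\<phi> (A y)) \<in> span {T (\<phi> (A x))} \<longleftrightarrow> y \<in> span {x}"
      by (simp add: T1 span_iff A0 A1)
  next
    fix a assume "a \<in> A -` C"
    then show "a \<noteq> 0"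
      using centre_nonzero A0 by auto
  next
    fix a x y assume "a \<in> A -` C" "y \<notin> span {a}" "x \<in> span {a, y}" "x \<noteq> 0"
    then show "T (\<phi> (A x)) \<in> span {T (\<phi> (A a)), T (\<phi> (A y))}"
      unfolding T2 by (intro line_into) (auto simp: A0 A1 A2)
  next
    fix a y u
    assume asm: "a \<in> A -` C" "y \<notin> span {a}" "u \<in> span {T (\<phi> (A a)), T (\<phi> (A y))}" "u \<noteq> 0"
    obtain v where v: "u = T v"
      using T(2) by (metis bij_pointE)
    have "v \<in> span {\<phi> (A a), \<phi> (A y)}" "v \<noteq> 0"
      using asm v T2 T0 by auto
    then obtain x where x: "x \<in> span {A a, A y}" "x \<noteq> 0" "v \<in> span {\<phi> x}"
      using line_onto[of "A a" "A y" v] asm A1 by auto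
    obtain x' where x': "x = A x'"
      using A(2) by (metis bij_pointE)
    show "\<exists>x\<in>span {a, y}. x \<noteq> 0 \<and> u \<in> span {T (\<phi> (A x))}"
      using x x' v by (intro bexI[of _ x']) (auto simp: A0 A2 T1)
  qed
qed

end

section \<open>The affine chart in which the centres are the coordinate directions and the origin\<close>

lemma independent_axes: "independent ((\<lambda>k. axis k (1::real)) ` S :: (real ^ 'm) set)"
proof -
  have "(\<lambda>k. axis k (1::real)) ` S \<subseteq> (Basis :: (real ^ 'm) set)"
    by (auto simp: Basis_vec_def)
  then show ?thesis
    using independent_Basis independent_mono by blast
qed

lemma sum_axis: "(\<Sum>k\<in>UNIV. x $ k *\<^sub>R axis k 1) = (x :: real ^ 'm)"
  by (simp add: vec_eq_iff axis_def if_distrib[of "\<lambda>c. _ * c"] cong: if_cong)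

lemma span_axes_hyperplane:
  "x \<in> span ((\<lambda>k. axis k (1::real)) ` (- {z})) \<longleftrightarrow> (x :: real ^ 'm) $ z = 0"
proof
  have "span ((\<lambda>k. axis k (1::real)) ` (- {z})) \<subseteq> {x :: real ^ 'm. x $ z = 0}"
    by (rule span_minimal) (auto simp: axis_def subspace_def)
  then show "x $ z = 0" if "x \<in> span ((\<lambda>k. axis k (1::real)) ` (- {z}))"
    using that by blast
next
  assume z: "x $ z = 0"
  have "(\<Sum>k\<in>UNIV. x $ k *\<^sub>R axis k 1) \<in> span ((\<lambda>k. axis k (1::real)) ` (- {z}))"
  proof (rule span_sum)
    fix k :: 'm
    show "x $ k *\<^sub>R axis k 1 \<in> span ((\<lambda>k. axis k (1::real)) ` (- {z}))"
      using z by (cases "k = z") (auto intro: span_scale span_base span_zero)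
  qed
  then show "x \<in> span ((\<lambda>k. axis k (1::real)) ` (- {z}))"
    by (simp only: sum_axis)
qed

text \<open>
  The points with \<open>z\<close>-coordinate \<open>1\<close> form the affine chart, and a projective line meets the chart in
  an affine line.
\<close>
lemma affine_combination_of_span:
  fixes a b c :: "real ^ 'm"
  assumes "c \<in> span {a, b}" "a $ z = 1" "b $ z = 1" "c $ z = 1"
  shows "\<exists>s. c = a + s *\<^sub>R (b - a)"
proof -
  obtain k s where c: "c = k *\<^sub>R a + s *\<^sub>R b"
    using assms(1) by (auto simp: span_insert span_singleton algebra_simps)
  then have "k = 1 - s" using assms(2-) by simp
  then have "c = (1 - s) *\<^sub>R a + s *\<^sub>R b"
    using c by simp
  then have "c = a + s *\<^sub>R (b - a)"
    by (simp add: algebra_simps)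
  then show ?thesis ..
qed

lemma span_axis_singleton: "x \<in> span {axis k (1::real)} \<longleftrightarrow> (\<forall>j. j \<noteq> k \<longrightarrow> (x :: real ^ 'm) $ j = 0)"
proof
  assume "\<forall>j. j \<noteq> k \<longrightarrow> x $ j = 0"
  then have "x = (x $ k) *\<^sub>R axis k 1"
    by (simp add: vec_eq_iff axis_def)
  then show "x \<in> span {axis k 1}"
    by (auto simp: span_singleton)
qed (auto simp: span_singleton axis_def)

text \<open>
  The axis \<open>z\<close> is the origin of the chart; the other axes are the points at infinity in the
  directions of the coordinates.
\<close>
locale axis_star_collineation = star_collineation \<phi> C
  for \<phi> :: "real ^ 'm \<Rightarrow> real ^ 'm" and C +
  fixes z :: 'm
  assumes axis_centre: "axis k 1 \<in> C"
    and axis_fixed: "\<phi> (axis k 1) \<in> span {axis k 1}"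
begin

text \<open>
  On the affine chart \<open>x $ z = 1\<close>, \<open>g x\<close> is the lift of the image that lies in the chart again.
\<close>
definition g :: "real ^ 'm \<Rightarrow> real ^ 'm" where
  "g x = (1 / \<phi> x $ z) *\<^sub>R \<phi> x"

text \<open>
  The action of \<open>g\<close> on the \<open>j\<close>-th coordinate axis of the chart, which turns out to describe the
  \<open>j\<close>-th coordinate of \<open>g\<close> everywhere.
\<close>
definition coord :: "'m \<Rightarrow> real \<Rightarrow> real" where
  "coord j t = g (axis z 1 + t *\<^sub>R axis j 1) $ j"

text \<open>
  The hyperplane at infinity is spanned by fixed centres, so \<open>in_span_of_centres_iff\<close> applies to it.
\<close>
lemma hyperplane_iff:
  assumes "x \<noteq> 0"
  shows "\<phi> x $ z = 0 \<longleftrightarrow> x $ z = 0"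
proof -
  let ?B = "(\<lambda>k. axis k (1::real)) ` (- {z}) :: (real ^ 'm) set"
  have "axis k 1 \<in> span {\<phi> (axis k 1)}" for k
    using span_singleton_swap[OF axis_fixed] nonzero centre_nonzero axis_centre by blast
  then have "?B \<subseteq> span (\<phi> ` ?B)"
    using span_mono[of "{\<phi> (axis _ 1)}" "\<phi> ` ?B"] by blast
  moreover have "\<phi> ` ?B \<subseteq> span ?B"
    using span_mono[of "{axis _ 1}" ?B] axis_fixed by blast
  ultimately have "span (\<phi> ` ?B) = span ?B"
    by (intro equalityI span_minimal) auto
  then show ?thesis
    using in_span_of_centres_iff[of ?B x] assms axis_centre independent_axes
      span_axes_hyperplane[of x z] span_axes_hyperplane[of "\<phi> x" z] by auto
qed

lemma chart_nonzero: "(x :: real ^ 'm) $ z = 1 \<Longrightarrow> x \<noteq> 0"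
  by auto

lemma g_z: "x $ z = 1 \<Longrightarrow> g x $ z = 1"
  using hyperplane_iff[OF chart_nonzero] by (simp add: g_def)

lemma span_g:
  assumes "x $ z = 1"
  shows "span {g x} = span {\<phi> x}"
proof (rule span_singleton_eq)
  show "g x \<in> span {\<phi> x}" by (auto simp: g_def span_singleton)
  show "g x \<noteq> 0" using g_z[OF assms] by auto
qed

lemma g_inj:
  assumes "x $ z = 1" "y $ z = 1" "g x = g y"
  shows "x = y"
proof -
  have "\<phi> x \<in> span {\<phi> y}"
    using span_g[OF assms(1)] span_g[OF assms(2)] assms(3) by (auto intro: span_base)
  then have "x \<in> span {y}"
    using span_iff[of y x] chart_nonzero assms by blast
  then show ?thesis
    using assms by (auto simp: span_singleton)
qed

lemma span_pair_g:
  assumes "x $ z = 1"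
  shows "span {a, \<phi> x} = span {a, g x}"
proof -
  have "\<phi> x \<in> span {g x}" "g x \<in> span {\<phi> x}"
    using span_g[OF assms] by (auto intro: span_base)
  then show ?thesis
    using span_mono[of "{g x}" "{a, g x}"] span_mono[of "{\<phi> x}" "{a, \<phi> x}"]
    by (intro equalityI span_minimal) (auto intro: span_base)
qed

lemma line_through_affine_centre:
  assumes "a \<in> C" "a $ z = 1" "y $ z = 1" "y \<noteq> a"
  shows "\<exists>s. g (a + t *\<^sub>R (y - a)) = g a + s *\<^sub>R (g y - g a)"
proof -
  let ?x = "a + t *\<^sub>R (y - a)"
  have x: "?x $ z = 1" using assms by simp
  have "y \<notin> span {a}" using assms by (auto simp: span_singleton)
  moreover have "?x \<in> span {a, y}"
    by (intro span_add span_scale span_diff) (auto intro: span_base)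
  ultimately have "\<phi> ?x \<in> span {\<phi> a, \<phi> y}"
    using line_into assms(1) chart_nonzero[OF x] by blast
  then have "\<phi> ?x \<in> span {g a, g y}"
    using span_pair_g[OF assms(3), of "\<phi> a"] span_pair_g[OF assms(2), of "g y"]
    by (simp add: insert_commute)
  then have "g ?x \<in> span {g a, g y}"
    by (simp add: g_def span_scale)
  then show ?thesis
    using affine_combination_of_span g_z assms x by blast
qed

text \<open>
  The two points lie on a line through the centre at infinity \<open>axis k 1\<close>. This centre is fixed, so
  their images differ only in direction \<open>k\<close>.
\<close>
lemma line_in_axis_direction:
  assumes "x $ z = 1" "k \<noteq> z" "j \<noteq> k"
  shows "g (x + t *\<^sub>R axis k 1) $ j = g x $ j"
proof -
  let ?y = "x + t *\<^sub>R axis k 1"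
  have y: "?y $ z = 1" using assms by (simp add: axis_def)
  have "x \<notin> span {axis k 1}"
    using assms by (auto simp: span_axis_singleton)
  moreover have "?y \<in> span {axis k 1, x}"
    by (intro span_add span_scale) (auto intro: span_base)
  ultimately have "\<phi> ?y \<in> span {\<phi> (axis k 1), \<phi> x}"
    using line_into axis_centre chart_nonzero[OF y] by blast
  also have "\<dots> = span {\<phi> (axis k 1), g x}"
    by (rule span_pair_g) fact
  also have "\<dots> \<subseteq> span {axis k 1, g x}"
    using axis_fixed span_mono[of "{axis k 1}" "{axis k 1, g x}"]
    by (intro span_minimal) (auto intro: span_base)
  finally have "g ?y \<in> span {axis k 1, g x}"
    by (simp add: g_def span_scale)
  then obtain c d where gy: "g ?y = c *\<^sub>R axis k 1 + d *\<^sub>R g x"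
    by (auto simp: span_insert span_singleton algebra_simps)
  then have "d = 1"
    using g_z[OF y] g_z[OF assms(1)] assms by (simp add: axis_def)
  then show ?thesis
    using gy assms by (simp add: axis_def)
qed

lemma g_coordinatewise:
  assumes "x $ z = 1" "j \<noteq> z"
  shows "g x $ j = coord j (x $ j)"
proof -
  have *: "g x $ j = g y $ j"
    if "finite S" "z \<notin> S" "j \<notin> S" "x $ z = 1" "\<And>k. k \<notin> S \<Longrightarrow> x $ k = y $ k" for S x y
    using that
  proof (induction S arbitrary: x rule: finite_induct)
    case empty
    then have "x = y" by (simp add: vec_eq_iff)
    then show ?case by simp
  next
    case (insert k S)
    let ?x = "x + (y $ k - x $ k) *\<^sub>R axis k 1"
    have "g ?x $ j = g y $ j"
      using insert.prems by (intro insert.IH) (auto simp: axis_def)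
    then show ?case
      using line_in_axis_direction[of x k j] insert.prems by auto
  qed
  show ?thesis
    unfolding coord_def using assms
    by (intro *[of "- {z, j}"]) (auto simp: axis_def)
qed

lemma g_origin: "g (axis z 1) = axis z 1"
proof -
  have "\<phi> (axis z 1) \<in> span {axis z 1}" by (rule axis_fixed)
  then obtain c where "\<phi> (axis z 1) = c *\<^sub>R axis z 1"
    by (auto simp: span_singleton)
  moreover have "\<phi> (axis z 1) \<noteq> 0"
    using nonzero centre_nonzero axis_centre by blast
  ultimately show ?thesis by (simp add: g_def axis_def)
qed

lemma coord_0: "j \<noteq> z \<Longrightarrow> coord j 0 = 0"
  by (simp add: coord_def g_origin) (simp add: axis_def)

lemma coord_inj:
  assumes "j \<noteq> z" "coord j s = coord j t"
  shows "s = t"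
proof -
  let ?p = "\<lambda>s. axis z 1 + s *\<^sub>R axis j 1 :: real ^ 'm"
  have p: "?p s $ z = 1" for s using assms by (simp add: axis_def)
  have pj: "?p s $ j = s" and pi: "i \<noteq> z \<Longrightarrow> i \<noteq> j \<Longrightarrow> ?p s $ i = 0" for s i
    using assms by (simp_all add: axis_def)
  have "g (?p s) $ i = g (?p t) $ i" for i
  proof (cases "i = z")
    case True
    then show ?thesis using g_z[OF p] by simp
  next
    case False
    have "coord i (?p s $ i) = coord i (?p t $ i)"
      using assms(2) pj pi[OF False] by (cases "i = j") simp_all
    then show ?thesis using g_coordinatewise[OF p False] by simp
  qed
  then have "g (?p s) = g (?p t)"
    by (intro vec_eq_iff[THEN iffD2] allI)
  then have "?p s = ?p t"
    by (rule g_inj[OF p p])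
  then show ?thesis using pj by metis
qed

lemma coord_1_nonzero: "j \<noteq> z \<Longrightarrow> coord j 1 \<noteq> 0"
  using coord_inj[of j 1 0] coord_0 by auto

text \<open>
  The point with coordinates \<open>1\<close> and \<open>r\<close> in the directions \<open>i\<close> and \<open>j\<close>, and its multiple by \<open>t\<close>, lie
  on a line through the origin.
\<close>
lemma coord_line_through_origin:
  assumes "i \<noteq> z" "j \<noteq> z" "i \<noteq> j"
  shows "\<exists>c. coord i t = c * coord i 1 \<and> coord j (t * r) = c * coord j r"
proof -
  let ?y = "axis z 1 + (axis i 1 + r *\<^sub>R axis j 1) :: real ^ 'm"
  let ?x = "axis z 1 + t *\<^sub>R (?y - axis z 1)"
  have y: "?y $ z = 1" and x: "?x $ z = 1" and o: "(axis z 1 :: real ^ 'm) $ z = 1"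
    using assms by (auto simp: axis_def)
  have "?y $ i \<noteq> axis z 1 $ i" using assms by (simp add: axis_def)
  then have "?y \<noteq> axis z 1" by metis
  then obtain c where c: "g ?x = axis z 1 + c *\<^sub>R (g ?y - axis z 1)"
    using line_through_affine_centre[OF axis_centre o y] g_origin by metis
  have "g ?x $ k = c * g ?y $ k" if "k \<noteq> z" for k
    unfolding c using that by (simp add: axis_def)
  then have "coord k (?x $ k) = c * coord k (?y $ k)" if "k \<noteq> z" for k
    using g_coordinatewise[OF x that] g_coordinatewise[OF y that] that by simp
  from this[of i] this[of j] show ?thesis
    using assms by (auto simp: axis_def)
qed

text \<open>
  The comparison takes place between two directions other than \<open>z\<close>: \<open>r = 1\<close> in \<open>coord_line_through_origin\<close> shows that the
  normalized coordinate functions agree, and general \<open>r\<close> then shows that they are multiplicative.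
\<close>
lemma coord_common_multiplicative:
  assumes "CARD('m) \<ge> 3"
  shows "\<exists>f. inj f \<and> (\<forall>s t. f (s * t) = f s * f t) \<and> (\<forall>j t. j \<noteq> z \<longrightarrow> coord j t = coord j 1 * f t)"
proof -
  have "card (UNIV - {z}) \<ge> 2"
    using assms by (simp add: card_Diff_singleton)
  then obtain S where "S \<subseteq> UNIV - {z}" "card S = 2"
    by (metis obtain_subset_with_card_n)
  then obtain a b where ab: "a \<noteq> z" "b \<noteq> z" "a \<noteq> b"
    by (auto simp: card_2_iff)
  define f where "f t = coord a t / coord a 1" for t
  have f: "coord j t = coord j 1 * f t" if j: "j \<noteq> z" for j t
  proof (cases "j = a")
    case False
    then obtain c where "coord a t = c * coord a 1" "coord j t = c * coord j 1"
      using coord_line_through_origin[of a j t 1] ab j by auto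
    then show ?thesis
      using coord_1_nonzero[of a] ab by (simp add: f_def)
  qed (use ab coord_1_nonzero f_def in simp)
  have "inj f"
    using coord_inj[of a] coord_1_nonzero[of a] ab by (auto simp: f_def intro!: injI)
  moreover have "f (s * t) = f s * f t" for s t
  proof -
    obtain c where c: "coord a s = c * coord a 1" "coord b (s * t) = c * coord b t"
      using coord_line_through_origin[of a b s t] ab by auto
    then have "c = f s" using coord_1_nonzero[of a] ab by (simp add: f_def)
    then have "coord b 1 * f (s * t) = coord b 1 * (f s * f t)"
      using c(2) f[OF ab(2)] by (metis mult.left_commute)
    then show ?thesis
      using coord_1_nonzero[OF ab(2)] by simp
  qed
  ultimately show ?thesis using f by blast
qed

text \<open>
  The lines through the centre \<open>w\<close> are used in the plane of two coordinates \<open>a\<close> and \<open>b\<close>, where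
  \<open>w $ a \<noteq> 0\<close>. By multiplicativity, \<open>f (w $ a)\<close> cancels in direction \<open>a\<close> and leaves the values of \<open>f\<close> at
  \<open>1\<close>, \<open>1 + t\<close> and \<open>2\<close>, as the slope equation requires.
\<close>
lemma coord_linear:
  assumes card: "CARD('m) \<ge> 3" and w: "w \<in> C" "w $ z = 1" "w \<noteq> axis z 1" and j: "j \<noteq> z"
  shows "coord j t = coord j 1 * t"
proof -
  obtain f where f: "inj f" "\<And>s t. f (s * t) = f s * f t"
      "\<And>j t. j \<noteq> z \<Longrightarrow> coord j t = coord j 1 * f t"
    using coord_common_multiplicative[OF card] by blast
  obtain a where "w $ a \<noteq> axis z 1 $ a"
    using w(3) by (meson vec_eq_iff)
  then have a: "a \<noteq> z" "w $ a \<noteq> 0"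
    using w(2) by (auto simp: axis_def split: if_splits)
  have "card (UNIV - {z, a}) \<ge> 1"
    using card a by (simp add: card_Diff_subset)
  then obtain b where b: "b \<noteq> z" "b \<noteq> a"
    by (auto simp: card_le_Suc_iff)
  have f1: "f 1 = 1"
    using f(3)[OF a(1), of 1] coord_1_nonzero[OF a(1)] by simp
  have f0: "f 0 = 0"
    using f(3)[OF a(1), of 0] coord_0[OF a(1)] coord_1_nonzero[OF a(1)] by simp
  have fa: "f (w $ a) \<noteq> 0"
    using injD[OF f(1), of "w $ a" 0] f0 a by auto
  have "(f (w $ b + t * m) - f (w $ b)) * (f 2 - 1) = (f (1 + t) - 1) * (f (w $ b + m) - f (w $ b))"
    for t m
  proof -
    \<comment> \<open>The step \<open>w $ a\<close> in direction \<open>a\<close> makes the coordinates \<open>a\<close> of the points multiples of \<open>w $ a\<close>.\<close>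
    let ?y = "w + ((w $ a) *\<^sub>R axis a 1 + m *\<^sub>R axis b 1)"
    let ?x = "w + t *\<^sub>R (?y - w)"
    have y: "?y $ z = 1" and x: "?x $ z = 1"
      using w a b by (auto simp: axis_def)
    have "?y $ a \<noteq> w $ a" using a b by (simp add: axis_def)
    then have "?y \<noteq> w" by metis
    then obtain c where c: "g ?x = g w + c *\<^sub>R (g ?y - g w)"
      using line_through_affine_centre[OF w(1,2) y] by metis
    have "g ?x $ k - g w $ k = c * (g ?y $ k - g w $ k)" for k
      unfolding c by simp
    then have "coord k (?x $ k) - coord k (w $ k) = c * (coord k (?y $ k) - coord k (w $ k))"
      if "k \<noteq> z" for k
      by (simp only: g_coordinatewise[OF x that, symmetric] g_coordinatewise[OF y that, symmetric]
          g_coordinatewise[OF w(2) that, symmetric])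
    then have "coord k 1 * f (?x $ k) - coord k 1 * f (w $ k)
        = c * (coord k 1 * f (?y $ k) - coord k 1 * f (w $ k))" if "k \<noteq> z" for k
      using that f(3)[OF that, of "?x $ k"] f(3)[OF that, of "?y $ k"] f(3)[OF that, of "w $ k"]
      by metis
    moreover have "r - s = c * (r' - s)" if "d * r - d * s = c * (d * r' - d * s)" "d \<noteq> 0"
      for d r r' s :: real
    proof -
      have "d * (r - s) = d * (c * (r' - s))" using that(1) by (simp add: algebra_simps)
      then show ?thesis using that(2) by simp
    qed
    ultimately have diff: "f (?x $ k) - f (w $ k) = c * (f (?y $ k) - f (w $ k))" if "k \<noteq> z" for k
      using coord_1_nonzero[OF that] that by blast
    have xa: "?x $ a = w $ a * (1 + t)" and ya: "?y $ a = w $ a * 2"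
      using b by (simp_all add: axis_def algebra_simps)
    have "f (w $ a) * f (1 + t) - f (w $ a) = c * (f (w $ a) * f 2 - f (w $ a))"
      using diff[OF a(1)] by (simp only: xa ya f(2))
    then have "f (w $ a) * (f (1 + t) - 1) = f (w $ a) * (c * (f 2 - 1))"
      by (simp add: algebra_simps)
    then have "f (1 + t) - 1 = c * (f 2 - 1)"
      using fa by simp
    moreover have "f (w $ b + t * m) - f (w $ b) = c * (f (w $ b + m) - f (w $ b))"
      using diff[OF b(1)] b by (simp add: axis_def)
    ultimately show ?thesis by simp
  qed
  then have "f t = t"
    by (rule multiplicative_slope_equation_eq_id[OF f(1,2)])
  then show ?thesis using f(3)[OF j, of t] by simp
qed

lemma diagonal:
  assumes card: "CARD('m) \<ge> 3" and w: "w \<in> C" "w $ z = 1" "w \<noteq> axis z 1"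
  shows "\<exists>D. linear D \<and> bij D \<and> (\<forall>x. x \<noteq> 0 \<longrightarrow> \<phi> x \<in> span {D x})"
proof -
  define d where "d k = (if k = z then 1 else coord k 1)" for k
  define D :: "real ^ 'm \<Rightarrow> real ^ 'm" where "D x = (\<chi> k. d k * x $ k)" for x
  have d0: "d k \<noteq> 0" for k by (simp add: d_def coord_1_nonzero)
  have D: "linear D"
    by (rule linearI) (auto simp: D_def vec_eq_iff algebra_simps)
  have "bij D"
    by (rule bij_betw_byWitness[of _ "\<lambda>x. \<chi> k. x $ k / d k"])
      (auto simp: D_def vec_eq_iff d0)
  have chart: "g x = D x" if "x $ z = 1" for x
  proof -
    have "g x $ k = D x $ k" for k
    proof (cases "k = z")
      case True
      then show ?thesis using g_z[OF that] that by (simp add: D_def d_def)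
    next
      case False
      then show ?thesis
        using g_coordinatewise[OF that False] coord_linear[OF card w False, of "x $ k"]
        by (simp add: D_def d_def)
    qed
    then show ?thesis by (intro vec_eq_iff[THEN iffD2] allI)
  qed
  have "\<phi> x \<in> span {D x}" if x: "x \<noteq> 0" for x
  proof (cases "x $ z = 0")
    case False
    define y where "y = (1 / x $ z) *\<^sub>R x"
    have y: "y $ z = 1" "y \<noteq> 0" using False by (auto simp: y_def)
    have "x = x $ z *\<^sub>R y" using False by (simp add: y_def)
    then have xy: "x \<in> span {y}" by (auto simp: span_singleton)
    then have "\<phi> x \<in> span {\<phi> y}" using span_iff x y by blast
    then have "\<phi> x \<in> span {D y}" using span_g[OF y(1)] chart[OF y(1)] by simp
    moreover have "D y \<in> span {D x}"
      using linear_scale[OF D] by (auto simp: y_def span_singleton)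
    ultimately show ?thesis using span_minimal[of "{D y}" "span {D x}"] by auto
  next
    case True
    \<comment> \<open>Here \<open>x\<close> is the point at infinity of the line that joins the origin to \<open>?y\<close>.\<close>
    let ?y = "axis z 1 + x"
    have y: "?y $ z = 1" using True by (simp add: axis_def)
    have "?y \<notin> span {axis z 1}"
    proof
      assume "?y \<in> span {axis z 1}"
      then have "?y $ j = 0" if "j \<noteq> z" for j
        using that by (metis span_axis_singleton)
      then have "x $ j = 0" for j
        using True by (cases "j = z") (auto simp: axis_def)
      then show False using x by (simp add: vec_eq_iff)
    qed
    moreover have "x = ?y - axis z 1" by simp
    then have "x \<in> span {axis z 1, ?y}"
      by (metis span_diff span_base insertI1 insertI2)
    ultimately have "\<phi> x \<in> span {\<phi> (axis z 1), \<phi> ?y}"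
      using line_into axis_centre x by blast
    also have "\<dots> = span {\<phi> (axis z 1), D ?y}"
      using span_pair_g[OF y] chart[OF y] by simp
    also have "\<dots> \<subseteq> span {axis z 1, D ?y}"
      using axis_fixed[of z] span_mono[of "{axis z 1}" "{axis z 1, D ?y}"]
      by (intro span_minimal) (auto intro: span_base)
    finally obtain p q where pq: "\<phi> x = p *\<^sub>R axis z 1 + q *\<^sub>R D ?y"
      by (auto simp: span_insert span_singleton algebra_simps)
    have "\<phi> x $ z = 0" using hyperplane_iff[OF x] True by simp
    then have "p + q = 0"
      using pq True by (simp add: D_def d_def axis_def)
    then have "\<phi> x = q *\<^sub>R D x"
      using pq True by (auto simp: vec_eq_iff D_def d_def axis_def algebra_simps)
    then show ?thesis by (auto simp: span_singleton)
  qed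
  then show ?thesis using D \<open>bij D\<close> by blast
qed

end

section \<open>From projective points to lifts\<close>

lemma RP_imp_lift:
  assumes "L \<in> RP"
  shows "\<exists>v. is_lift v L"
proof -
  have L: "subspace L" "dim L = 1" using assms by (auto simp: RP_def)
  obtain B where B: "B \<subseteq> L" "independent B" "L \<subseteq> span B" "card B = dim L"
    using basis_exists by blast
  then obtain v where v: "B = {v}"
    using L by (auto simp: card_1_singleton_iff)
  then have "span {v} = L"
    using B L by (metis span_minimal subset_antisym)
  then show ?thesis
    using B v by (auto simp: is_lift_def)
qed

lemma span_in_RP: "v \<noteq> 0 \<Longrightarrow> span {v} \<in> RP"
  by (simp add: RP_def)

lemma span_in_projectivization_iff:
  assumes "v \<noteq> 0" "subspace V"
  shows "span {v} \<in> projectivization V \<longleftrightarrow> v \<in> V"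
  using assms span_in_RP[of v] span_minimal[of "{v}" V]
  by (auto simp: projectivization_def intro: span_base)

lemma dim_span_pair:
  fixes a y :: "real ^ 'm"
  assumes "a \<noteq> 0" "y \<notin> span {a}"
  shows "dim (span {a, y}) = 2"
proof -
  have "independent {y, a}"
    using assms by (simp add: independent_insertI)
  moreover have "y \<noteq> a" using assms by (auto intro: span_base)
  ultimately show ?thesis
    using dim_eq_card_independent[of "{y, a}"] by (simp add: insert_commute)
qed

text \<open>
  The image of the line \<open>span {a, y}\<close> is a line that contains the distinct images of \<open>a\<close> and \<open>y\<close>,
  hence it is the line spanned by them.
\<close>
lemma star_collineation_of_lifts:
  fixes F :: "(real ^ 'm) set \<Rightarrow> (real ^ 'm) set"
  assumes F: "F \<in> RP \<rightarrow> RP" "inj_on F RP"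
    and lines: "\<And>l. proj_line l \<Longrightarrow> \<exists>L\<in>P. L \<in> l \<Longrightarrow> proj_line (F ` l)"
    and \<phi>: "\<And>x. x \<noteq> 0 \<Longrightarrow> is_lift (\<phi> x) (F (span {x}))"
  shows "star_collineation \<phi> {a. a \<noteq> 0 \<and> span {a} \<in> P}"
proof -
  have \<phi>0: "\<phi> x \<noteq> 0" if "x \<noteq> 0" for x using \<phi>[OF that] by (simp add: is_lift_def)
  have \<phi>F: "span {\<phi> x} = F (span {x})" if "x \<noteq> 0" for x
    using \<phi>[OF that] by (simp add: is_lift_def)
  have span_iff: "\<phi> y \<in> span {\<phi> x} \<longleftrightarrow> y \<in> span {x}" if "x \<noteq> 0" "y \<noteq> 0" for x y
  proof -
    have "\<phi> y \<in> span {\<phi> x} \<longleftrightarrow> span {\<phi> y} = span {\<phi> x}"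
      using span_singleton_eq[of "\<phi> y" "\<phi> x"] \<phi>0 that by (auto intro: span_base)
    also have "\<dots> \<longleftrightarrow> span {y} = span {x}"
      using that \<phi>F F(2) span_in_RP by (metis inj_onD)
    also have "\<dots> \<longleftrightarrow> y \<in> span {x}"
      using span_singleton_eq[of y x] that by (auto intro: span_base)
    finally show ?thesis .
  qed
  have line: "F ` projectivization (span {a, y}) = projectivization (span {\<phi> a, \<phi> y})"
    if a: "a \<noteq> 0" "span {a} \<in> P" and y: "y \<notin> span {a}" for a y
  proof -
    have y0: "y \<noteq> 0" using y by (auto simp: span_zero)
    let ?l = "projectivization (span {a, y})"
    have mem: "span {a} \<in> ?l" "span {y} \<in> ?l"
      using a y0 by (auto simp: span_in_projectivization_iff intro: span_base)
    have "proj_line ?l"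
      unfolding proj_line_def using dim_span_pair[OF a(1) y] subspace_span by blast
    then have "proj_line (F ` ?l)" using lines a mem by blast
    then obtain V where V: "subspace V" "dim V = 2" "F ` ?l = projectivization V"
      by (auto simp: proj_line_def)
    have "span {\<phi> a} \<in> projectivization V" "span {\<phi> y} \<in> projectivization V"
      using mem V(3) \<phi>F a y0 by auto
    then have "\<phi> a \<in> V" "\<phi> y \<in> V"
      using span_in_projectivization_iff V(1) \<phi>0 a y0 by blast+
    then have "span {\<phi> a, \<phi> y} \<subseteq> V"
      using V(1) by (intro span_minimal) auto
    moreover have "dim (span {\<phi> a, \<phi> y}) = 2"
      using span_iff[OF a(1) y0] y \<phi>0 a by (intro dim_span_pair) auto
    ultimately have "span {\<phi> a, \<phi> y} = V"
      using V by (intro subspace_dim_equal) auto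
    then show ?thesis using V by simp
  qed
  show ?thesis
  proof
    show "\<phi> x \<noteq> 0" if "x \<noteq> 0" for x by (rule \<phi>0) fact
    show "\<phi> y \<in> span {\<phi> x} \<longleftrightarrow> y \<in> span {x}" if "x \<noteq> 0" "y \<noteq> 0" for x y
      by (rule span_iff) fact+
    show "a \<noteq> 0" if "a \<in> {a. a \<noteq> 0 \<and> span {a} \<in> P}" for a
      using that by simp
  next
    fix a x y
    assume asm: "a \<in> {a. a \<noteq> 0 \<and> span {a} \<in> P}" "y \<notin> span {a}" "x \<in> span {a, y}" "x \<noteq> 0"
    then have "span {x} \<in> projectivization (span {a, y})"
      by (simp add: span_in_projectivization_iff)
    then have "span {\<phi> x} \<in> projectivization (span {\<phi> a, \<phi> y})"
      using line[of a y] asm \<phi>F by blast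
    then show "\<phi> x \<in> span {\<phi> a, \<phi> y}"
      using asm \<phi>0 by (simp add: span_in_projectivization_iff)
  next
    fix a y u
    assume asm: "a \<in> {a. a \<noteq> 0 \<and> span {a} \<in> P}" "y \<notin> span {a}" "u \<in> span {\<phi> a, \<phi> y}" "u \<noteq> 0"
    then have "span {u} \<in> projectivization (span {\<phi> a, \<phi> y})"
      by (simp add: span_in_projectivization_iff)
    then have "span {u} \<in> F ` projectivization (span {a, y})"
      using line[of a y] asm by simp
    then obtain L where L: "L \<in> projectivization (span {a, y})" "span {u} = F L"
      by blast
    then obtain x where x: "x \<noteq> 0" "span {x} = L"
      using RP_imp_lift[of L] by (auto simp: projectivization_def is_lift_def)
    then have "x \<in> span {a, y}"
      using L(1) span_in_projectivization_iff[of x] by auto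
    moreover have "u \<in> span {\<phi> x}"
      using L(2) x \<phi>F by (auto intro: span_base)
    ultimately show "\<exists>x\<in>span {a, y}. x \<noteq> 0 \<and> u \<in> span {\<phi> x}" using x by blast
  qed
qed

lemma coordinate_frame:
  fixes b :: "'m \<Rightarrow> real ^ 'm"
  assumes "inj b" "independent (range b)"
  shows "\<exists>A. linear A \<and> bij A \<and> (\<forall>x. A x = (\<Sum>k\<in>UNIV. x $ k *\<^sub>R b k)) \<and> (\<forall>k. A (axis k 1) = b k)"
proof -
  define A where "A x = (\<Sum>k\<in>UNIV. x $ k *\<^sub>R b k)" for x :: "real ^ 'm"
  have A: "linear A"
    by (rule linearI) (auto simp: A_def scaleR_add_left sum.distrib scaleR_sum_right)
  have axis: "A (axis k 1) = b k" for k
    by (simp add: A_def axis_def if_distrib[of "\<lambda>c. c *\<^sub>R _"] cong: if_cong)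
  have "card (range b) = CARD('m)"
    using assms(1) by (simp add: card_image)
  then have "dim (range b) = DIM(real ^ 'm)"
    using assms(2) dim_eq_card_independent[of "range b"] by simp
  then have "span (range b) = UNIV"
    by (simp only: dim_eq_full)
  moreover have "span (range b) \<subseteq> range A"
    using A axis by (intro span_minimal) (auto simp: linear_subspace_image intro: rangeI simp flip: axis)
  ultimately have "surj A" by auto
  then have "bij A"
    using A linear_surjective_imp_injective[of A] by (auto simp: bij_def)
  then show ?thesis using A axis A_def by blast
qed

theorem theorem1p7:
  fixes n :: nat
    and p :: "nat \<Rightarrow> (real ^ 'm) set"
    and F :: "(real ^ 'm) set \<Rightarrow> (real ^ 'm) set"
  assumes "n \<ge> 2"
    and "CARD('m) = n + 1"
    and "\<And>i. i \<in> {1..n+2} \<Longrightarrow> p i \<in> RP"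
    and "generic (n + 1) p"
    and "p (n + 2) \<notin> proj_span (p ` {1..n})"
    and "p (n + 2) \<noteq> p (n + 1)"
    and "F \<in> RP \<rightarrow> RP"
    and "inj_on F RP"
    and "\<And>l. proj_line l \<Longrightarrow> \<exists>i\<in>{1..n+2}. p i \<in> l \<Longrightarrow> proj_line (F ` l)"
  shows "projective_linear F"
proof -
  have "\<exists>v. is_lift v (p i)" if "i \<in> {1..n+2}" for i
    using RP_imp_lift assms(3) that by blast
  then obtain v where v: "\<And>i. i \<in> {1..n+2} \<Longrightarrow> is_lift (v i) (p i)"
    by metis
  have "\<exists>u. is_lift u (F (span {x}))" if "x \<noteq> 0" for x
    using RP_imp_lift span_in_RP[OF that] assms(7) by blast
  then obtain \<phi> where \<phi>: "\<And>x. x \<noteq> 0 \<Longrightarrow> is_lift (\<phi> x) (F (span {x}))"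
    by metis
  define C where "C = {a. a \<noteq> 0 \<and> span {a} \<in> p ` {1..n+2}}"
  interpret star_collineation \<phi> C
    unfolding C_def using assms(7-9) \<phi>
    by (intro star_collineation_of_lifts) auto
  have vC: "v i \<in> C" if "i \<in> {1..n+2}" for i
    using v[OF that] that by (auto simp: C_def is_lift_def)
  obtain \<sigma> :: "'m \<Rightarrow> nat" where \<sigma>: "bij_betw \<sigma> UNIV {1..n+1}"
    using assms(2) by (metis card_atLeastAtMost diff_Suc_1 finite finite_atLeastAtMost
        finite_same_card_bij Suc_eq_plus1)
  define b where "b k = v (\<sigma> k)" for k
  have \<sigma>_in: "\<sigma> k \<in> {1..n+1}" for k using \<sigma> by (auto simp: bij_betw_def)
  have "inj_on v {1..n+1}" "independent (v ` {1..n+1})"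
    using assms(2,4) v unfolding generic_def by auto
  moreover have "inj \<sigma>" "range \<sigma> = {1..n+1}" using \<sigma> by (simp_all add: bij_betw_def)
  ultimately have b: "inj b" "independent (range b)"
    using comp_inj_on[of \<sigma> UNIV v] image_comp[of v \<sigma> UNIV]
    by (simp_all add: b_def[abs_def] comp_def)
  have bC: "range b \<subseteq> C"
    using vC \<sigma>_in by (force simp: b_def)
  have "independent (\<phi> ` range b)" "inj_on \<phi> (range b)"
    using span_of_centres[OF _ bC b(2)] by auto
  then have \<phi>b: "inj (\<lambda>k. \<phi> (b k))" "independent (range (\<lambda>k. \<phi> (b k)))"
    using b(1) by (auto simp: inj_on_def image_comp comp_def)
  obtain A where A: "linear A" "bij A" "\<And>x. A x = (\<Sum>k\<in>UNIV. x $ k *\<^sub>R b k)"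
      "\<And>k. A (axis k 1) = b k"
    using coordinate_frame[OF b] by blast
  obtain T :: "real ^ 'm \<Rightarrow> real ^ 'm" where T: "linear T" "bij T" "\<forall>k. T (axis k 1) = \<phi> (b k)"
    using coordinate_frame[OF \<phi>b] by blast
  have T': "linear (inv T)" "bij (inv T)"
    using T by (simp_all add: inj_linear_imp_inv_linear bij_is_inj bij_imp_bij_inv)
  obtain z where z: "\<sigma> z = n + 1"
    using \<sigma> unfolding bij_betw_def by (metis atLeastAtMost_iff imageE le_add2 order_refl)
  interpret N: star_collineation "\<lambda>x. inv T (\<phi> (A x))" "A -` C"
    by (rule transport) fact+
  interpret N: axis_star_collineation "\<lambda>x. inv T (\<phi> (A x))" "A -` C" z
  proof
    fix k :: 'm
    show "axis k 1 \<in> A -` C" using bC A(4) by auto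
    show "inv T (\<phi> (A (axis k 1))) \<in> span {axis k 1}"
      using T(2,3) A(4) by (metis bij_is_inj inv_f_f span_base insertI1)
  qed
  define q where "q = inv A (v (n + 2))"
  have Aq: "A q = v (n + 2)" using A(2) by (simp add: q_def bij_is_surj surj_f_inv_f)
  have last: "v (n + 2) \<noteq> 0" "span {v (n + 2)} = p (n + 2)"
    using v[of "n + 2"] by (auto simp: is_lift_def)
  \<comment> \<open>The last centre is not at infinity, because it is not in the span of the first \<open>n\<close> centres.\<close>
  have qz: "q $ z \<noteq> 0"
  proof
    assume 0: "q $ z = 0"
    have "A q \<in> span (\<Union> (p ` {1..n}))"
      unfolding A(3)
    proof (rule span_sum)
      fix k :: 'm
      show "q $ k *\<^sub>R b k \<in> span (\<Union> (p ` {1..n}))"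
      proof (cases "k = z")
        case False
        then have "\<sigma> k \<noteq> n + 1"
          using \<sigma> z by (metis bij_betw_def UNIV_I inj_onD)
        then have k: "\<sigma> k \<in> {1..n}" using \<sigma>_in[of k] by auto
        then have "b k \<in> p (\<sigma> k)"
          using v[of "\<sigma> k"] by (auto simp: b_def is_lift_def intro: span_base)
        then have "b k \<in> span (\<Union> (p ` {1..n}))"
          using k by (intro span_base) blast
        then show ?thesis by (rule span_scale)
      qed (simp add: 0 span_zero)
    qed
    then have "p (n + 2) \<in> projectivization (span (\<Union> (p ` {1..n})))"
      using last Aq span_in_projectivization_iff[of "v (n + 2)"] by auto
    moreover have "p ` {1..n} \<subseteq> RP" using assms(3) by auto
    ultimately show False
      using assms(5) proj_span_eq by blast
  qed
  define w where "w = (1 / q $ z) *\<^sub>R q"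
  have w1: "w $ z = 1" using qz by (simp add: w_def)
  have Aw: "A w = (1 / q $ z) *\<^sub>R v (n + 2)"
    using linear_scale[OF A(1)] by (simp add: w_def Aq)
  then have Aw0: "A w \<noteq> 0" using qz last by simp
  have spanAw: "span {A w} = p (n + 2)"
    using span_singleton_eq[of "A w" "v (n + 2)"] Aw Aw0 last by (auto simp: span_singleton)
  have wC: "w \<in> A -` C"
    using Aw0 spanAw by (auto simp: C_def)
  have "w \<noteq> axis z 1"
  proof
    assume "w = axis z 1"
    then have "span {A w} = p (n + 1)"
      using v[of "n + 1"] A(4)[of z] z by (auto simp: b_def is_lift_def)
    then show False using spanAw assms(6) by simp
  qed
  then obtain D where D: "linear D" "bij D" "\<And>x. x \<noteq> 0 \<Longrightarrow> inv T (\<phi> (A x)) \<in> span {D x}"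
    using N.diagonal[OF _ wC w1] assms(1,2) by auto
  define f where "f x = T (D (inv A x))" for x
  have A': "linear (inv A)" "bij (inv A)"
    using A by (simp_all add: inj_linear_imp_inv_linear bij_is_inj bij_imp_bij_inv)
  have f: "linear f" "bij f"
    using linear_compose[OF A'(1) linear_compose[OF D(1) T(1)]]
      bij_comp[OF A'(2) bij_comp[OF D(2) T(2)]]
    by (simp_all add: f_def[abs_def] comp_def)
  have "F L = f ` L" if L: "L \<in> RP" for L
  proof -
    obtain x where x: "x \<noteq> 0" "span {x} = L"
      using RP_imp_lift[OF L] by (auto simp: is_lift_def)
    have "inv A x \<noteq> 0"
      using x A by (metis bij_is_surj surj_f_inv_f linear_0)
    then have "inv T (\<phi> x) \<in> span {D (inv A x)}"
      using D(3)[of "inv A x"] A(2) by (simp add: bij_is_surj surj_f_inv_f)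
    then have "T (inv T (\<phi> x)) \<in> T ` span {D (inv A x)}" by blast
    then have "\<phi> x \<in> span {f x}"
      using T by (simp add: bij_is_surj surj_f_inv_f f_def flip: linear_span_image)
    then have "span {\<phi> x} = span {f x}"
      by (rule span_singleton_eq) (rule nonzero, fact)
    then have "F L = span {f x}"
      using \<phi>[OF x(1)] x(2) by (simp add: is_lift_def)
    also have "\<dots> = f ` L"
      using linear_span_image[OF f(1), of "{x}"] x(2) by simp
    finally show ?thesis .
  qed
  then show ?thesis
    unfolding projective_linear_def using f by blast
qed

end
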